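(* Let $k$ be a field, let $\mathbf{a}=(a_1,\dots,a_n),\mathbf{b}=(b_1,\dots,b_n)\in\mathbb{N}^n$ with $(\mathbf{a},\mathbf{b})$ fan ordered, let $\mathcal{B}=\mathcal{B}((\mathbf{x}^{\mathbf{a}}),(\mathbf{x}^{\mathbf{b}}))$ be the intersection algebra of the ideals $(x_1^{a_1}\cdots x_n^{a_n})$ and $(x_1^{b_1}\cdots x_n^{b_n})$ of $k[x_1,\dots,x_n]$, and let $\Phi=\Phi_{\mathbf{a},\mathbf{b}}$. Let $$C=\{\boldsymbol\gamma+(0,0,1,\dots,1) : \boldsymbol\gamma\in\mathrm{FUND}_\Phi\setminus(\{\boldsymbol\alpha_1,\dots,\boldsymbol\alpha_n\}\cup\{\boldsymbol\beta(1,0),\boldsymbol\beta(0,1)\})\}.$$ Then the canonical module of $\mathcal{B}$ is generated by the monomials $\mathbf{x}^{\boldsymbol\beta}$, where $\boldsymbol\beta\in C$ (monomials being regarded as elements of $\mathcal{B}$ via the isomorphism $R_\Phi\cong\mathcal{B}$).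
   Context: $\mathbb{N}$ denotes the nonnegative integers. The intersection algebra of ideals $I,J$ of a ring $R$ is $\mathcal{B}(I,J)=\sum_{r,s\in\mathbb{N}}(I^r\cap J^s)u^rv^s\subseteq R[u,v]$. $(\mathbf{a},\mathbf{b})$ is fan ordered if $a_i/b_i\ge a_{i+1}/b_{i+1}$ for all $i=1,\dots,n-1$, with the convention $a_i/b_i=\infty$ if $b_i=0$. $\Phi_{\mathbf{a},\mathbf{b}}$ is the $2n\times(3n+2)$ integer matrix of the linear system $a_ir+h_i-m_i=0$, $b_is+k_i-m_i=0$ ($i=1,\dots,n$) in the unknowns $(r,s,h_1,k_1,m_1,\dots,h_n,k_n,m_n)$, and $E_\Phi=\{\boldsymbol\beta\in\mathbb{N}^{3n+2} : \Phi\boldsymbol\beta=0\}$. $R_\Phi=k[E_\Phi]$ is its semigroup algebra, with $\boldsymbol\beta\in E_\Phi$ written as the monomial $\mathbf{x}^{\boldsymbol\beta}$ in $3n+2$ variables. The isomorphism $R_\Phi\cong\mathcal{B}$ sends $\mathbf{x}^{\boldsymbol\beta}$, for $\boldsymbol\beta=(r,s,h_1,k_1,m_1,\dots,h_n,k_n,m_n)$, to $x_1^{m_1}\cdots x_n^{m_n}u^rv^s$. For $j=1,\dots,n$ let $\pi_j(\boldsymbol\beta)=(r,s,h_j,k_j,m_j)$. A nonzero $\boldsymbol\beta\in E_\Phi$ is fundamental if $\boldsymbol\beta=\boldsymbol\gamma+\boldsymbol\delta$ with $\boldsymbol\gamma,\boldsymbol\delta\in E_\Phi$ implies $\boldsymbol\gamma=\boldsymbol\beta$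 or $\boldsymbol\delta=\boldsymbol\beta$; $\mathrm{FUND}_\Phi$ is the set of fundamental elements. $\boldsymbol\alpha_i\in E_\Phi$ is the vector with $\pi_i(\boldsymbol\alpha_i)=(0,0,1,1,1)$ and $\pi_j(\boldsymbol\alpha_i)=(0,0,0,0,0)$ for $j\ne i$. For $(r,s)\in\mathbb{N}^2$, $\boldsymbol\beta(r,s)\in E_\Phi$ is the vector with $\pi_j(\boldsymbol\beta(r,s))=(r,s,\max(a_jr,b_js)-a_jr,\max(a_jr,b_js)-b_js,\max(a_jr,b_js))$ for all $j=1,\dots,n$. The ring $\mathcal{B}$ is Cohen-Macaulay; its canonical module is realized as the canonical ideal of $R_\Phi$, the $k$-span of the monomials $\mathbf{x}^{\boldsymbol\beta}$ with $\boldsymbol\beta\in E_\Phi$ having all coordinates positive.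
   Formalization: The formal statement also assumes a_i > 0 and b_i > 0 for some i; if a_i b_i = 0 for every i (e.g. n = 1, a = b = 0), C is empty while the canonical module is nonzero, so the claim fails. *)

theory Defs
  imports
    "HOL-Algebra.Ideal_Product"
    "HOL-Library.Poly_Mapping"
    "HOL-Library.Product_Plus"
    "HOL-Library.Extended_Real"
    "Jordan_Normal_Form.Matrix"
begin

text \<open>
  Polynomials are finitely supported functions from exponents to coefficients: an element of
  \<^typ>\<open>(nat \<Rightarrow>\<^sub>0 nat) \<Rightarrow>\<^sub>0 'k\<close> is a polynomial over \<^typ>\<open>'k\<close> in variables indexed by
  \<^typ>\<open>nat\<close>. The vectors a and b are functions on \<^typ>\<open>nat\<close> of which only the values at
  1, ..., n are used.
\<close>

definition sub_ring :: "'r::comm_ring_1 set \<Rightarrow> 'r ring" where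
  "sub_ring A = \<lparr>carrier = A, monoid.mult = (*), one = 1, zero = 0, add = (+)\<rparr>"

definition slope :: "nat \<Rightarrow> nat \<Rightarrow> ereal" where
  "slope p q = (if q = 0 then \<infinity> else ereal (real p / real q))"

definition fan_ordered :: "nat \<Rightarrow> (nat \<Rightarrow> nat) \<Rightarrow> (nat \<Rightarrow> nat) \<Rightarrow> bool" where
  "fan_ordered n a b \<longleftrightarrow> (\<forall>i\<in>{1..<n}. slope (a i) (b i) \<ge> slope (a (Suc i)) (b (Suc i)))"


subsection \<open>The intersection algebra\<close>

text \<open>
  An element of R[u,v] is a finitely supported function on exponents
  (r, s) with values in R. Ideal powers are taken in the semiring of ideals of R, whose
  one is R itself.
\<close>

definition intersection_algebra :: "'r::comm_ring_1 ring \<Rightarrow> 'r set \<Rightarrow> 'r set \<Rightarrow> (nat \<times> nat \<Rightarrow>\<^sub>0 'r) ring" where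
  "intersection_algebra R I J = sub_ring
     {f. \<forall>r s. Poly_Mapping.lookup f (r, s)
               \<in> (I [^]\<^bsub>ideals_set R\<^esub> r) \<inter> (J [^]\<^bsub>ideals_set R\<^esub> s)}"

definition poly_ring :: "nat \<Rightarrow> ((nat \<Rightarrow>\<^sub>0 nat) \<Rightarrow>\<^sub>0 'k::field) ring" where
  "poly_ring n = sub_ring {p. \<forall>m\<in>Poly_Mapping.keys p. Poly_Mapping.keys m \<subseteq> {1..n}}"

definition monomial :: "(nat \<Rightarrow>\<^sub>0 nat) \<Rightarrow> (nat \<Rightarrow>\<^sub>0 nat) \<Rightarrow>\<^sub>0 'k::field" where
  "monomial m = Poly_Mapping.single m 1"

definition exponent :: "nat \<Rightarrow> (nat \<Rightarrow> nat) \<Rightarrow> (nat \<Rightarrow>\<^sub>0 nat)" where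
  "exponent n a = (\<Sum>i=1..n. Poly_Mapping.single i (a i))"

definition principal_intersection_algebra ::
    "nat \<Rightarrow> (nat \<Rightarrow> nat) \<Rightarrow> (nat \<Rightarrow> nat) \<Rightarrow> (nat \<times> nat \<Rightarrow>\<^sub>0 ((nat \<Rightarrow>\<^sub>0 nat) \<Rightarrow>\<^sub>0 'k::field)) ring" where
  "principal_intersection_algebra n a b = intersection_algebra (poly_ring n)
     (PIdl\<^bsub>poly_ring n\<^esub> (monomial (exponent n a)))
     (PIdl\<^bsub>poly_ring n\<^esub> (monomial (exponent n b)))"


subsection \<open>The linear system\<close>

text \<open>
  The unknowns (r, s, h_1, k_1, m_1, ..., h_n, k_n, m_n) have positions 0, ..., 3n + 1, so r and s
  are at 0 and 1, and h_i, k_i, m_i at the following positions. A vector of length 3n + 2 is a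
  finitely supported function with support below 3n + 2, so that it is itself the exponent of a
  monomial.
\<close>

abbreviation (input) pos_h :: "nat \<Rightarrow> nat" where "pos_h i \<equiv> 3 * i - 1"
abbreviation (input) pos_k :: "nat \<Rightarrow> nat" where "pos_k i \<equiv> 3 * i"
abbreviation (input) pos_m :: "nat \<Rightarrow> nat" where "pos_m i \<equiv> 3 * i + 1"

text \<open>
  Rows are counted from 0: row 2(i - 1) is a_i r + h_i - m_i = 0 and row 2(i - 1) + 1 is
  b_i s + k_i - m_i = 0.
\<close>

definition Phi :: "nat \<Rightarrow> (nat \<Rightarrow> nat) \<Rightarrow> (nat \<Rightarrow> nat) \<Rightarrow> int mat" where
  "Phi n a b = mat (2 * n) (3 * n + 2) (\<lambda>(p, j).
     let i = p div 2 + 1 in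
     if even p
     then (if j = 0 then int (a i) else if j = pos_h i then 1 else if j = pos_m i then - 1 else 0)
     else (if j = 1 then int (b i) else if j = pos_k i then 1 else if j = pos_m i then - 1 else 0))"

definition E_Phi :: "nat \<Rightarrow> (nat \<Rightarrow> nat) \<Rightarrow> (nat \<Rightarrow> nat) \<Rightarrow> (nat \<Rightarrow>\<^sub>0 nat) set" where
  "E_Phi n a b = {\<beta>. Poly_Mapping.keys \<beta> \<subseteq> {..<3 * n + 2} \<and>
     Phi n a b *\<^sub>v vec (3 * n + 2) (\<lambda>j. int (Poly_Mapping.lookup \<beta> j)) = 0\<^sub>v (2 * n)}"

definition FUND :: "nat \<Rightarrow> (nat \<Rightarrow> nat) \<Rightarrow> (nat \<Rightarrow> nat) \<Rightarrow> (nat \<Rightarrow>\<^sub>0 nat) set" where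
  "FUND n a b = {\<beta> \<in> E_Phi n a b. \<beta> \<noteq> 0 \<and>
     (\<forall>\<gamma>\<in>E_Phi n a b. \<forall>\<delta>\<in>E_Phi n a b. \<beta> = \<gamma> + \<delta> \<longrightarrow> \<gamma> = \<beta> \<or> \<delta> = \<beta>)}"

definition mk_vec :: "nat \<Rightarrow> nat \<Rightarrow> nat \<Rightarrow> (nat \<Rightarrow> nat) \<Rightarrow> (nat \<Rightarrow> nat) \<Rightarrow> (nat \<Rightarrow> nat) \<Rightarrow> (nat \<Rightarrow>\<^sub>0 nat)" where
  "mk_vec n r s h k m = Poly_Mapping.single 0 r + Poly_Mapping.single 1 s +
     (\<Sum>j=1..n. Poly_Mapping.single (pos_h j) (h j) + Poly_Mapping.single (pos_k j) (k j)
               + Poly_Mapping.single (pos_m j) (m j))"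

definition alpha_vec :: "nat \<Rightarrow> nat \<Rightarrow> (nat \<Rightarrow>\<^sub>0 nat)" where
  "alpha_vec n i = mk_vec n 0 0 (\<lambda>j. if j = i then 1 else 0) (\<lambda>j. if j = i then 1 else 0)
     (\<lambda>j. if j = i then 1 else 0)"

definition beta_vec :: "nat \<Rightarrow> (nat \<Rightarrow> nat) \<Rightarrow> (nat \<Rightarrow> nat) \<Rightarrow> nat \<Rightarrow> nat \<Rightarrow> (nat \<Rightarrow>\<^sub>0 nat)" where
  "beta_vec n a b r s = mk_vec n r s
     (\<lambda>j. max (a j * r) (b j * s) - a j * r)
     (\<lambda>j. max (a j * r) (b j * s) - b j * s)
     (\<lambda>j. max (a j * r) (b j * s))"

text \<open>
  If for every i one of a_i, b_i vanishes, the only fundamental elements are the removed ones and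
  this set is empty, although the canonical module is never zero; statements about generation need
  some i with both a_i and b_i positive.
\<close>

definition canonical_generators :: "nat \<Rightarrow> (nat \<Rightarrow> nat) \<Rightarrow> (nat \<Rightarrow> nat) \<Rightarrow> (nat \<Rightarrow>\<^sub>0 nat) set" where
  "canonical_generators n a b =
     {\<gamma> + mk_vec n 0 0 (\<lambda>_. 1) (\<lambda>_. 1) (\<lambda>_. 1) | \<gamma>.
        \<gamma> \<in> FUND n a b - (alpha_vec n ` {1..n} \<union> {beta_vec n a b 1 0, beta_vec n a b 0 1})}"


subsection \<open>The canonical module\<close>

definition k_span :: "((nat \<Rightarrow>\<^sub>0 nat) \<Rightarrow>\<^sub>0 'k::field) set \<Rightarrow> ((nat \<Rightarrow>\<^sub>0 nat) \<Rightarrow>\<^sub>0 'k) set" where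
  "k_span = module.span (\<lambda>c p. Poly_Mapping.single 0 c * p)"

definition canonical_ideal ::
    "nat \<Rightarrow> (nat \<Rightarrow> nat) \<Rightarrow> (nat \<Rightarrow> nat) \<Rightarrow> ((nat \<Rightarrow>\<^sub>0 nat) \<Rightarrow>\<^sub>0 'k::field) set" where
  "canonical_ideal n a b =
     k_span (monomial ` {\<beta> \<in> E_Phi n a b. \<forall>j<3 * n + 2. 0 < Poly_Mapping.lookup \<beta> j})"

text \<open>
  The k-linear map sending the monomial with exponent (r, s, h_1, k_1, m_1, ..., h_n, k_n, m_n) to
  x_1^{m_1} ... x_n^{m_n} u^r v^s. Restricted to the polynomials all of whose exponents lie in
  \<^const>\<open>E_Phi\<close>, it is the isomorphism onto the intersection algebra.
\<close>

definition to_B :: "nat \<Rightarrow> ((nat \<Rightarrow>\<^sub>0 nat) \<Rightarrow>\<^sub>0 'k::field) \<Rightarrow> (nat \<times> nat \<Rightarrow>\<^sub>0 ((nat \<Rightarrow>\<^sub>0 nat) \<Rightarrow>\<^sub>0 'k))" where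
  "to_B n p = (\<Sum>\<beta>\<in>Poly_Mapping.keys p.
     Poly_Mapping.single (Poly_Mapping.lookup \<beta> 0, Poly_Mapping.lookup \<beta> 1)
       (Poly_Mapping.single (exponent n (\<lambda>i. Poly_Mapping.lookup \<beta> (pos_m i)))
          (Poly_Mapping.lookup p \<beta>)))"

definition canonical_module ::
    "nat \<Rightarrow> (nat \<Rightarrow> nat) \<Rightarrow> (nat \<Rightarrow> nat) \<Rightarrow> (nat \<times> nat \<Rightarrow>\<^sub>0 ((nat \<Rightarrow>\<^sub>0 nat) \<Rightarrow>\<^sub>0 'k::field)) set" where
  "canonical_module n a b = to_B n ` canonical_ideal n a b"

end

theory Submission
  imports Defs
begin

text \<open>
  A vector of \<^const>\<open>E_Phi\<close> is determined by r, s and the slacks h and k, because every m is then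
  given by either equation; subtracting a vector of the semigroup that is smaller in r, s and all
  slacks stays in the semigroup. The monomials of the canonical ideal are those with r, s and all
  slacks positive, since each m is then positive as well.

  Let \<open>\<beta>\<close> be such an exponent, and let 1 denote the vector (0, 0, 1, ..., 1). Then \<open>\<beta> - 1\<close> is in the
  semigroup and still has positive r and s. Among the summands of \<open>\<beta> - 1\<close> with positive r and s
  choose one, \<open>\<gamma>\<close>, with minimal coordinate sum. In a decomposition of \<open>\<gamma>\<close> into two nonzero
  vectors neither part can have both r and s positive, so one part has s = 0 < r and the other
  r = 0 < s. For an index i with \<open>a i\<close> and \<open>b i\<close> positive the first part has \<open>k i > 0\<close> and the second
  \<open>h i > 0\<close>. Hence \<open>\<gamma>\<close> dominates the vector \<open>\<alpha>\<close> of i, and subtracting it contradicts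
  minimality. So \<open>\<gamma>\<close> is fundamental, and having r and s positive it is none of the removed vectors
  (\<open>inner_fund_below\<close>). Therefore \<open>\<beta> = (\<gamma> + 1) + \<delta>\<close> is a multiple of one of the asserted generators.

  Conversely a fundamental \<open>\<gamma>\<close> with r = 0 or s = 0 dominates some \<open>\<alpha>\<close> (if r = s = 0) or one of
  \<open>\<beta>(1,0)\<close>, \<open>\<beta>(0,1)\<close>, and so equals it (\<open>inner_fund_uv_pos\<close>); thus \<open>\<gamma> + 1\<close> lies in the canonical
  ideal for all \<open>\<gamma>\<close> that are kept.

  To turn these facts about exponents into an equality of ideals, both the intersection algebra and
  the canonical module are described by their monomials. Since a power of the principal ideal of
  \<open>x^a\<close> is the principal ideal of \<open>x^(r a)\<close>, the former consists of all polynomials whose monomials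
  \<open>x^m u^r v^s\<close> satisfy \<open>r a i \<le> m i\<close> and \<open>s b i \<le> m i\<close>; the latter corresponds to the strict
  inequalities together with r, s > 0, and is visibly an ideal of the former.
\<close>

abbreviation lookup :: "('x \<Rightarrow>\<^sub>0 'y::zero) \<Rightarrow> 'x \<Rightarrow> 'y" where "lookup \<equiv> Poly_Mapping.lookup"
abbreviation keys :: "('x \<Rightarrow>\<^sub>0 'y::zero) \<Rightarrow> 'x set" where "keys \<equiv> Poly_Mapping.keys"

section \<open>Coordinates of vectors\<close>

abbreviation ones :: "nat \<Rightarrow> (nat \<Rightarrow>\<^sub>0 nat)" where
  "ones n \<equiv> mk_vec n 0 0 (\<lambda>_. 1) (\<lambda>_. 1) (\<lambda>_. 1)"

lemma sum_when_single:
  fixes i n :: nat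
  assumes "i \<in> {1..n}" "\<And>j. j \<in> {1..n} \<Longrightarrow> q j = p \<longleftrightarrow> j = i"
  shows "(\<Sum>j=1..n. f j when q j = p) = (f i :: nat)"
proof -
  have "(\<Sum>j=1..n. f j when q j = p) = (\<Sum>j=1..n. if j = i then f i else 0)"
    by (rule sum.cong) (use assms in \<open>auto simp: when_def\<close>)
  then show ?thesis using assms(1) by auto
qed

lemma sum_when_none:
  "(\<And>j. j \<in> {1..n::nat} \<Longrightarrow> q j \<noteq> p) \<Longrightarrow> (\<Sum>j=1..n. f j when q j = p) = (0 :: nat)"
  by (intro sum.neutral) (auto simp: when_def)

lemma lookup_mk_vec:
  "lookup (mk_vec n r s h k m) p = (r when p = 0) + (s when p = 1)
     + ((\<Sum>j=1..n. h j when 3 * j - 1 = p) + (\<Sum>j=1..n. k j when 3 * j = p)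
     + (\<Sum>j=1..n. m j when 3 * j + 1 = p))"
  by (simp add: mk_vec_def lookup_add lookup_sum lookup_single sum.distrib eq_commute[of "Suc 0" p])

lemma lookup_mk_vec_coords:
  "lookup (mk_vec n r s h k m) 0 = r"
  "lookup (mk_vec n r s h k m) (Suc 0) = s"
  "i \<in> {1..n} \<Longrightarrow> lookup (mk_vec n r s h k m) (3 * i - 1) = h i"
  "i \<in> {1..n} \<Longrightarrow> lookup (mk_vec n r s h k m) (3 * i) = k i"
  "i \<in> {1..n} \<Longrightarrow> lookup (mk_vec n r s h k m) (3 * i + 1) = m i"
proof -
  have zero:
    "(\<Sum>j=1..n. h j when 3 * j - 1 = 0) = 0"
    "(\<Sum>j=1..n. h j when 3 * j - 1 = Suc 0) = 0"
    "(\<Sum>j=1..n. k j when 3 * j = 0) = 0"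
    "(\<Sum>j=1..n. k j when 3 * j = Suc 0) = 0"
    "(\<Sum>j=1..n. m j when 3 * j + 1 = 0) = 0"
    "(\<Sum>j=1..n. m j when 3 * j + 1 = Suc 0) = 0"
    by (rule sum_when_none, simp, linarith?)+
  show "lookup (mk_vec n r s h k m) 0 = r" "lookup (mk_vec n r s h k m) (Suc 0) = s"
    unfolding lookup_mk_vec zero by simp_all
  assume i: "i \<in> {1..n}"
  then have small: "3 * i - 1 \<noteq> 0" "3 * i - 1 \<noteq> 1" "3 * i \<noteq> 0" "3 * i \<noteq> 1" "3 * i + 1 \<noteq> 0" "3 * i + 1 \<noteq> 1"
    by auto
  have inj: "3 * j - 1 = 3 * i - 1 \<longleftrightarrow> j = i" "3 * j = 3 * i \<longleftrightarrow> j = i" "3 * j + 1 = 3 * i + 1 \<longleftrightarrow> j = i"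
    and disj: "3 * j \<noteq> 3 * i - 1" "3 * j - 1 \<noteq> 3 * i"
      "3 * j + 1 \<noteq> 3 * i - 1" "3 * j - 1 \<noteq> 3 * i + 1" "3 * j + 1 \<noteq> 3 * i" "3 * j \<noteq> 3 * i + 1"
    if j: "j \<in> {1..n}" for j
    using i j unfolding atLeastAtMost_iff by (cases i j rule: linorder_cases; linarith)+
  have one:
    "(\<Sum>j=1..n. h j when 3 * j - 1 = 3 * i - 1) = h i"
    "(\<Sum>j=1..n. k j when 3 * j = 3 * i) = k i"
    "(\<Sum>j=1..n. m j when 3 * j + 1 = 3 * i + 1) = m i"
    by (rule sum_when_single[OF i], erule inj)+
  have no:
    "(\<Sum>j=1..n. k j when 3 * j = 3 * i - 1) = 0"
    "(\<Sum>j=1..n. h j when 3 * j - 1 = 3 * i) = 0"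
    "(\<Sum>j=1..n. m j when 3 * j + 1 = 3 * i - 1) = 0"
    "(\<Sum>j=1..n. h j when 3 * j - 1 = 3 * i + 1) = 0"
    "(\<Sum>j=1..n. m j when 3 * j + 1 = 3 * i) = 0"
    "(\<Sum>j=1..n. k j when 3 * j = 3 * i + 1) = 0"
    by (rule sum_when_none, erule disj)+
  show "lookup (mk_vec n r s h k m) (3 * i - 1) = h i" "lookup (mk_vec n r s h k m) (3 * i) = k i"
    "lookup (mk_vec n r s h k m) (3 * i + 1) = m i"
    unfolding lookup_mk_vec one no by (simp_all only: small when_def if_False add_0_left add_0_right)
qed

lemma coords_cases:
  assumes "p < 3 * n + 2"
  obtains "p = 0" | "p = Suc 0"
    | i where "i \<in> {1..n}" "p = 3 * i - 1"
    | i where "i \<in> {1..n}" "p = 3 * i"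
    | i where "i \<in> {1..n}" "p = 3 * i + 1"
proof -
  define q where "q = p div 3"
  consider "p = 3 * q" | "p = 3 * q + 1" | "p = 3 * Suc q - 1"
    unfolding q_def by simp linarith
  then show thesis
  proof cases
    case 1 then show thesis using assms that(1) that(4)[of q] by (cases "q = 0") auto
  next
    case 2 then show thesis using assms that(2) that(5)[of q] by (cases "q = 0") auto
  next
    case 3 then show thesis using assms that(3)[of "Suc q"] by auto
  qed
qed

lemma keys_mk_vec: "keys (mk_vec n r s h k m) \<subseteq> {..<3 * n + 2}"
proof
  fix p assume p: "p \<in> keys (mk_vec n r s h k m)"
  show "p \<in> {..<3 * n + 2}"
  proof (rule ccontr)
    assume "p \<notin> {..<3 * n + 2}"
    then have large: "3 * n + 2 \<le> p" by simp
    have "(\<Sum>j=1..n. h j when 3 * j - 1 = p) = 0" "(\<Sum>j=1..n. k j when 3 * j = p) = 0"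
      "(\<Sum>j=1..n. m j when 3 * j + 1 = p) = 0"
      by (rule sum_when_none; use large in \<open>simp only: atLeastAtMost_iff, linarith\<close>)+
    then have "lookup (mk_vec n r s h k m) p = 0"
      unfolding lookup_mk_vec using large by (simp only: when_def) simp
    then show False using p by (simp add: in_keys_iff)
  qed
qed

section \<open>The semigroup of solutions\<close>

text \<open>
  Each row of the matrix has at most three nonzero entries. With m, whose coefficient is negative,
  moved to the other side, the two rows of an index become equations over the natural numbers.
\<close>

lemma E_Phi_iff:
  "\<beta> \<in> E_Phi n a b \<longleftrightarrow> keys \<beta> \<subseteq> {..<3 * n + 2} \<and>
     (\<forall>i\<in>{1..n}. a i * lookup \<beta> 0 + lookup \<beta> (3 * i - 1) = lookup \<beta> (3 * i + 1) \<and>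
                 b i * lookup \<beta> (Suc 0) + lookup \<beta> (3 * i) = lookup \<beta> (3 * i + 1))"
  (is "_ \<longleftrightarrow> _ \<and> (\<forall>i\<in>_. ?eqs i)")
proof -
  let ?x = "\<lambda>j. int (lookup \<beta> j)"
  let ?row = "\<lambda>p. \<Sum>j\<in>{0..<3 * n + 2}. Phi n a b $$ (p, j) * ?x j"
  have sparse: "(\<Sum>j\<in>{0..<3 * n + 2}. (if j = z then A else if j = p then 1 else if j = q then - 1 else 0) * ?x j)
      = A * ?x z + ?x p - ?x q"
    if "z < p" "p < q" "q < 3 * n + 2" for A :: int and z p q
  proof -
    have "(\<Sum>j\<in>{0..<3 * n + 2}. (if j = z then A else if j = p then 1 else if j = q then - 1 else 0) * ?x j)
       = (\<Sum>j\<in>{0..<3 * n + 2}. (if j = z then A * ?x z else 0) + (if j = p then ?x p else 0)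
            - (if j = q then ?x q else 0))"
      by (rule sum.cong) (use that in auto)
    also have "\<dots> = A * ?x z + ?x p - ?x q"
      using that by (simp add: sum.distrib sum_subtractf)
    finally show ?thesis .
  qed
  have even_row: "?row (2 * t) = int (a (Suc t)) * ?x 0 + ?x (3 * Suc t - 1) - ?x (3 * Suc t + 1)"
    and odd_row: "?row (2 * t + 1) = int (b (Suc t)) * ?x 1 + ?x (3 * Suc t) - ?x (3 * Suc t + 1)"
    if t: "t < n" for t
  proof -
    have "?row (2 * t) = (\<Sum>j\<in>{0..<3 * n + 2}.
        (if j = 0 then int (a (Suc t)) else if j = 3 * Suc t - 1 then 1
         else if j = 3 * Suc t + 1 then - 1 else 0) * ?x j)"
      using t by (intro sum.cong refl) (simp add: Phi_def Let_def)
    also have "\<dots> = int (a (Suc t)) * ?x 0 + ?x (3 * Suc t - 1) - ?x (3 * Suc t + 1)"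
      by (rule sparse) (use t in auto)
    finally show "?row (2 * t) = int (a (Suc t)) * ?x 0 + ?x (3 * Suc t - 1) - ?x (3 * Suc t + 1)" .
    have "?row (2 * t + 1) = (\<Sum>j\<in>{0..<3 * n + 2}.
        (if j = 1 then int (b (Suc t)) else if j = 3 * Suc t then 1
         else if j = 3 * Suc t + 1 then - 1 else 0) * ?x j)"
      using t by (intro sum.cong refl) (simp add: Phi_def Let_def)
    also have "\<dots> = int (b (Suc t)) * ?x 1 + ?x (3 * Suc t) - ?x (3 * Suc t + 1)"
      by (rule sparse) (use t in auto)
    finally show "?row (2 * t + 1) = int (b (Suc t)) * ?x 1 + ?x (3 * Suc t) - ?x (3 * Suc t + 1)" .
  qed
  have dims: "dim_row (Phi n a b) = 2 * n" "dim_col (Phi n a b) = 3 * n + 2"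
    by (simp_all add: Phi_def)
  have "Phi n a b *\<^sub>v vec (3 * n + 2) ?x = 0\<^sub>v (2 * n) \<longleftrightarrow> (\<forall>p<2 * n. ?row p = 0)"
    by (auto simp: vec_eq_iff dims scalar_prod_def)
  also have "\<dots> \<longleftrightarrow> (\<forall>t<n. ?row (2 * t) = 0 \<and> ?row (2 * t + 1) = 0)"
  proof (intro iffI allI impI)
    fix p assume *: "\<forall>t<n. ?row (2 * t) = 0 \<and> ?row (2 * t + 1) = 0" and "p < 2 * n"
    then have "p div 2 < n" by auto
    with * have "?row (2 * (p div 2)) = 0 \<and> ?row (2 * (p div 2) + 1) = 0" by blast
    moreover have "p = 2 * (p div 2) \<or> p = 2 * (p div 2) + 1" by presburger
    ultimately show "?row p = 0" by metis
  next
    fix t assume *: "\<forall>p<2 * n. ?row p = 0" and "t < n"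
    then have "2 * t < 2 * n" "2 * t + 1 < 2 * n" by auto
    with * show "?row (2 * t) = 0 \<and> ?row (2 * t + 1) = 0" by blast
  qed
  also have "\<dots> \<longleftrightarrow> (\<forall>t<n. ?eqs (Suc t))"
  proof (intro all_cong1 imp_cong refl)
    fix t assume t: "t < n"
    show "(?row (2 * t) = 0 \<and> ?row (2 * t + 1) = 0) \<longleftrightarrow> ?eqs (Suc t)"
      unfolding even_row[OF t] odd_row[OF t] diff_eq_eq add_0_left
      by (simp only: One_nat_def, simp only: of_nat_eq_iff flip: of_nat_mult of_nat_add)
  qed
  also have "\<dots> \<longleftrightarrow> (\<forall>i\<in>{1..n}. ?eqs i)"
    by (simp only: image_Suc_lessThan[symmetric] ball_simps) (simp only: Ball_def lessThan_iff)
  finally show ?thesis by (simp only: E_Phi_def mem_Collect_eq)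
qed

lemma E_Phi_eqs:
  assumes "\<beta> \<in> E_Phi n a b" "i \<in> {1..n}"
  shows "a i * lookup \<beta> 0 + lookup \<beta> (3 * i - 1) = lookup \<beta> (3 * i + 1)"
    and "b i * lookup \<beta> (Suc 0) + lookup \<beta> (3 * i) = lookup \<beta> (3 * i + 1)"
  using assms by (auto simp: E_Phi_iff)

lemma E_Phi_lookup_0:
  assumes "\<beta> \<in> E_Phi n a b" "\<not> p < 3 * n + 2"
  shows "lookup \<beta> p = 0"
proof -
  have "keys \<beta> \<subseteq> {..<3 * n + 2}" using assms(1) unfolding E_Phi_iff by blast
  with assms(2) have "p \<notin> keys \<beta>" by blast
  then show ?thesis by (simp only: in_keys_iff not_not)
qed

lemma E_PhiI:
  assumes "keys \<beta> \<subseteq> {..<3 * n + 2}"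
    and "\<And>i. i \<in> {1..n} \<Longrightarrow> a i * lookup \<beta> 0 + lookup \<beta> (3 * i - 1) = lookup \<beta> (3 * i + 1)"
    and "\<And>i. i \<in> {1..n} \<Longrightarrow> b i * lookup \<beta> (Suc 0) + lookup \<beta> (3 * i) = lookup \<beta> (3 * i + 1)"
  shows "\<beta> \<in> E_Phi n a b"
  using assms unfolding E_Phi_iff by blast

lemma E_Phi_add:
  assumes "\<gamma> \<in> E_Phi n a b" "\<delta> \<in> E_Phi n a b"
  shows "\<gamma> + \<delta> \<in> E_Phi n a b"
proof (rule E_PhiI)
  show "keys (\<gamma> + \<delta>) \<subseteq> {..<3 * n + 2}"
    using assms keys_add[of \<gamma> \<delta>] unfolding E_Phi_iff by blast
  fix i assume i: "i \<in> {1..n}"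
  show "a i * lookup (\<gamma> + \<delta>) 0 + lookup (\<gamma> + \<delta>) (3 * i - 1) = lookup (\<gamma> + \<delta>) (3 * i + 1)"
    "b i * lookup (\<gamma> + \<delta>) (Suc 0) + lookup (\<gamma> + \<delta>) (3 * i) = lookup (\<gamma> + \<delta>) (3 * i + 1)"
    unfolding lookup_add distrib_left using E_Phi_eqs[OF assms(1) i] E_Phi_eqs[OF assms(2) i]
    by linarith+
qed

text \<open>
  The divisibility test in the semigroup. Comparing r, s and the slacks suffices, since by the
  equations m is monotone in r and h.
\<close>

lemma E_Phi_split:
  assumes "\<beta> \<in> E_Phi n a b" "\<gamma> \<in> E_Phi n a b"
    and uv: "lookup \<gamma> 0 \<le> lookup \<beta> 0" "lookup \<gamma> (Suc 0) \<le> lookup \<beta> (Suc 0)"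
    and h: "\<And>i. i \<in> {1..n} \<Longrightarrow> lookup \<gamma> (3 * i - 1) \<le> lookup \<beta> (3 * i - 1)"
    and k: "\<And>i. i \<in> {1..n} \<Longrightarrow> lookup \<gamma> (3 * i) \<le> lookup \<beta> (3 * i)"
  shows "\<beta> - \<gamma> \<in> E_Phi n a b" and "\<beta> = \<gamma> + (\<beta> - \<gamma>)"
proof -
  have le: "lookup \<gamma> p \<le> lookup \<beta> p" for p
  proof (cases "p < 3 * n + 2")
    case True
    then show ?thesis
    proof (cases rule: coords_cases)
      case (5 i)
      have "a i * lookup \<gamma> 0 \<le> a i * lookup \<beta> 0" using uv(1) by simp
      then show ?thesis
        using E_Phi_eqs(1)[OF assms(1) 5(1)] E_Phi_eqs(1)[OF assms(2) 5(1)] h[OF 5(1)]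
        unfolding 5(2) by linarith
    qed (simp_all only: uv h k)
  next
    case False
    then show ?thesis using E_Phi_lookup_0[OF assms(2)] by simp
  qed
  then show eq: "\<beta> = \<gamma> + (\<beta> - \<gamma>)"
    by (intro poly_mapping_eqI) (simp add: lookup_add lookup_minus)
  then have add: "lookup \<beta> p = lookup \<gamma> p + lookup (\<beta> - \<gamma>) p" for p
    by (metis lookup_add)
  show "\<beta> - \<gamma> \<in> E_Phi n a b"
  proof (rule E_PhiI)
    have "keys (\<beta> - \<gamma>) \<subseteq> keys \<beta>" by (auto simp: in_keys_iff lookup_minus)
    then show "keys (\<beta> - \<gamma>) \<subseteq> {..<3 * n + 2}"
      using assms(1) unfolding E_Phi_iff by blast
    fix i assume i: "i \<in> {1..n}"
    show "a i * lookup (\<beta> - \<gamma>) 0 + lookup (\<beta> - \<gamma>) (3 * i - 1) = lookup (\<beta> - \<gamma>) (3 * i + 1)"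
      "b i * lookup (\<beta> - \<gamma>) (Suc 0) + lookup (\<beta> - \<gamma>) (3 * i) = lookup (\<beta> - \<gamma>) (3 * i + 1)"
      using E_Phi_eqs[OF assms(1) i] E_Phi_eqs[OF assms(2) i]
      unfolding add distrib_left by linarith+
  qed
qed

lemma mk_vec_in_E_PhiI:
  assumes "\<And>i. i \<in> {1..n} \<Longrightarrow> a i * r + h i = m i" "\<And>i. i \<in> {1..n} \<Longrightarrow> b i * s + k i = m i"
  shows "mk_vec n r s h k m \<in> E_Phi n a b"
  by (rule E_PhiI[OF keys_mk_vec])
    (simp_all only: lookup_mk_vec_coords assms)

lemma ones_in_E_Phi: "ones n \<in> E_Phi n a b"
  by (rule mk_vec_in_E_PhiI) simp_all

lemma alpha_in_E_Phi: "alpha_vec n i \<in> E_Phi n a b"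
  unfolding alpha_vec_def by (rule mk_vec_in_E_PhiI) simp_all

lemma beta_in_E_Phi: "beta_vec n a b r s \<in> E_Phi n a b"
  unfolding beta_vec_def by (rule mk_vec_in_E_PhiI) simp_all

section \<open>Fundamental elements\<close>

lemma FUND_E: "\<gamma> \<in> FUND n a b \<Longrightarrow> \<gamma> \<in> E_Phi n a b"
  by (simp add: FUND_def)

text \<open>
  A fundamental vector is minimal: it dominates no nonzero vector of the semigroup but itself.
\<close>

lemma FUND_eqI:
  assumes "\<gamma> \<in> FUND n a b" "\<epsilon> \<in> E_Phi n a b" "\<epsilon> \<noteq> 0"
    and "lookup \<epsilon> 0 \<le> lookup \<gamma> 0" "lookup \<epsilon> (Suc 0) \<le> lookup \<gamma> (Suc 0)"
    and "\<And>i. i \<in> {1..n} \<Longrightarrow> lookup \<epsilon> (3 * i - 1) \<le> lookup \<gamma> (3 * i - 1)"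
    and "\<And>i. i \<in> {1..n} \<Longrightarrow> lookup \<epsilon> (3 * i) \<le> lookup \<gamma> (3 * i)"
  shows "\<gamma> = \<epsilon>"
proof -
  note split = E_Phi_split[OF FUND_E[OF assms(1)] assms(2,4-7)]
  then have "\<epsilon> = \<gamma> \<or> \<gamma> - \<epsilon> = \<gamma>"
    using assms(1,2) unfolding FUND_def by blast
  moreover have "\<gamma> - \<epsilon> \<noteq> \<gamma>"
    using split(2) assms(3) by (metis add_cancel_left_left)
  ultimately show ?thesis by simp
qed

lemma alpha_vec_nonzero: "i \<in> {1..n} \<Longrightarrow> alpha_vec n i \<noteq> 0"
proof
  assume "i \<in> {1..n}" "alpha_vec n i = 0"
  then have "lookup (alpha_vec n i) (3 * i) = 0" by simp
  then show False
    unfolding alpha_vec_def lookup_mk_vec_coords(4)[OF \<open>i \<in> {1..n}\<close>] by simp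
qed

text \<open>
  The slacks at i alone decide whether the vector \<open>\<alpha>\<close> of i can be split off.
\<close>

lemma E_Phi_split_alpha:
  assumes "\<beta> \<in> E_Phi n a b" "i \<in> {1..n}" "0 < lookup \<beta> (3 * i - 1)" "0 < lookup \<beta> (3 * i)"
  shows "\<beta> - alpha_vec n i \<in> E_Phi n a b" "\<beta> = alpha_vec n i + (\<beta> - alpha_vec n i)"
proof -
  have uv: "lookup (alpha_vec n i) 0 \<le> lookup \<beta> 0" "lookup (alpha_vec n i) (Suc 0) \<le> lookup \<beta> (Suc 0)"
    by (simp_all only: alpha_vec_def lookup_mk_vec_coords le0)
  have h: "lookup (alpha_vec n i) (3 * j - 1) \<le> lookup \<beta> (3 * j - 1)"
    and k: "lookup (alpha_vec n i) (3 * j) \<le> lookup \<beta> (3 * j)" if j: "j \<in> {1..n}" for j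
    unfolding alpha_vec_def lookup_mk_vec_coords(3,4)[OF j]
    using assms(3,4) by (cases "j = i"; simp)+
  show "\<beta> - alpha_vec n i \<in> E_Phi n a b"
    by (rule E_Phi_split(1)[OF assms(1) alpha_in_E_Phi uv h k])
  show "\<beta> = alpha_vec n i + (\<beta> - alpha_vec n i)"
    by (rule E_Phi_split(2)[OF assms(1) alpha_in_E_Phi uv h k])
qed

text \<open>
  The fundamental vectors that give rise to generators. They turn out to be exactly the fundamental
  vectors whose r and s are both positive.
\<close>

abbreviation inner_fund :: "nat \<Rightarrow> (nat \<Rightarrow> nat) \<Rightarrow> (nat \<Rightarrow> nat) \<Rightarrow> (nat \<Rightarrow>\<^sub>0 nat) set" where
  "inner_fund n a b \<equiv>
     FUND n a b - (alpha_vec n ` {1..n} \<union> {beta_vec n a b 1 0, beta_vec n a b 0 1})"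

text \<open>
  If r = s = 0, some m is positive, and then both slacks at that index equal m; so an \<open>\<alpha>\<close> splits off.
  If just one of r and s vanishes, \<open>\<beta>(1,0)\<close> or \<open>\<beta>(0,1)\<close> splits off: the slacks belonging to the
  positive unknown of that vector vanish, and the other slacks of the given vector equal its m.
\<close>

lemma inner_fund_uv_pos:
  assumes "\<gamma> \<in> inner_fund n a b"
  shows "0 < lookup \<gamma> 0" and "0 < lookup \<gamma> (Suc 0)"
proof -
  have F: "\<gamma> \<in> FUND n a b" and E: "\<gamma> \<in> E_Phi n a b" using assms FUND_E by auto
  note uv_beta = lookup_mk_vec_coords(1,2)[of n r s "\<lambda>j. max (a j * r) (b j * s) - a j * r"
      "\<lambda>j. max (a j * r) (b j * s) - b j * s" "\<lambda>j. max (a j * r) (b j * s)" for r s, folded beta_vec_def]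
  have not_both: False if z: "lookup \<gamma> 0 = 0" "lookup \<gamma> (Suc 0) = 0"
  proof -
    have "\<gamma> \<noteq> 0" using F unfolding FUND_def by blast
    then obtain p where p: "lookup \<gamma> p \<noteq> 0" by (metis poly_mapping_eqI lookup_zero)
    have "p < 3 * n + 2" using p E_Phi_lookup_0[OF E, of p] by metis
    then obtain i where i: "i \<in> {1..n}" "0 < lookup \<gamma> (3 * i + 1)"
    proof (cases rule: coords_cases)
      case (3 i)
      with p E_Phi_eqs(1)[OF E 3(1)] that[of i] show thesis by simp
    next
      case (4 i)
      with p E_Phi_eqs(2)[OF E 4(1)] that[of i] show thesis by simp
    next
      case (5 i)
      with p that[of i] show thesis by simp
    qed (use z p in simp_all)
    have hk: "0 < lookup \<gamma> (3 * i - 1)" "0 < lookup \<gamma> (3 * i)"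
      using i(2) E_Phi_eqs[OF E i(1)] unfolding z by simp_all
    note split = E_Phi_split_alpha[OF E i(1) hk]
    then have "alpha_vec n i = \<gamma> \<or> \<gamma> - alpha_vec n i = \<gamma>"
      using F alpha_in_E_Phi unfolding FUND_def by blast
    moreover have "\<gamma> - alpha_vec n i \<noteq> \<gamma>"
      using split(2) alpha_vec_nonzero[OF i(1)] by (metis add_cancel_left_left)
    ultimately show False using assms i(1) by blast
  qed
  have axis: "\<gamma> = beta_vec n a b r s"
    if rs: "r \<le> lookup \<gamma> 0" "s \<le> lookup \<gamma> (Suc 0)" "r = 0 \<and> lookup \<gamma> 0 = 0 \<and> 0 < s \<or> s = 0 \<and> lookup \<gamma> (Suc 0) = 0 \<and> 0 < r"
    for r s
  proof (rule FUND_eqI[OF F beta_in_E_Phi])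
    show "beta_vec n a b r s \<noteq> 0"
      using uv_beta[of r s] rs(3) by (metis lookup_zero less_not_refl)
    show "lookup (beta_vec n a b r s) 0 \<le> lookup \<gamma> 0" "lookup (beta_vec n a b r s) (Suc 0) \<le> lookup \<gamma> (Suc 0)"
      using rs(1,2) unfolding uv_beta by blast+
    fix i assume i: "i \<in> {1..n}"
    have "b i * s \<le> b i * lookup \<gamma> (Suc 0)" "a i * r \<le> a i * lookup \<gamma> 0"
      using rs(1,2) by simp_all
    note le = this E_Phi_eqs[OF E i]
    consider "r = 0" "lookup \<gamma> 0 = 0" | "s = 0" "lookup \<gamma> (Suc 0) = 0" using rs(3) by metis
    then have "max (a i * r) (b i * s) - a i * r \<le> lookup \<gamma> (3 * i - 1)
        \<and> max (a i * r) (b i * s) - b i * s \<le> lookup \<gamma> (3 * i)"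
    proof cases
      case 1
      show ?thesis using le unfolding 1 mult_0_right by linarith
    next
      case 2
      show ?thesis using le unfolding 2 mult_0_right by linarith
    qed
    then show "lookup (beta_vec n a b r s) (3 * i - 1) \<le> lookup \<gamma> (3 * i - 1)"
      "lookup (beta_vec n a b r s) (3 * i) \<le> lookup \<gamma> (3 * i)"
      unfolding beta_vec_def lookup_mk_vec_coords(3,4)[OF i] by blast+
  qed
  show "0 < lookup \<gamma> 0"
  proof (rule ccontr)
    assume "\<not> 0 < lookup \<gamma> 0"
    then have z: "lookup \<gamma> 0 = 0" by simp
    then have "lookup \<gamma> (Suc 0) \<noteq> 0" using not_both by metis
    with z have "\<gamma> = beta_vec n a b 0 1" by (intro axis) simp_all
    then show False using assms by blast
  qed
  show "0 < lookup \<gamma> (Suc 0)"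
  proof (rule ccontr)
    assume "\<not> 0 < lookup \<gamma> (Suc 0)"
    then have z: "lookup \<gamma> (Suc 0) = 0" by simp
    then have "lookup \<gamma> 0 \<noteq> 0" using not_both by metis
    with z have "\<gamma> = beta_vec n a b 1 0" by (intro axis) simp_all
    then show False using assms by blast
  qed
qed

text \<open>
  A summand with positive r and s whose coordinate sum is minimal turns out to be fundamental.
  Without an index i at which both exponents are positive,
  \<open>\<beta>(1,1) = \<beta>(1,0) + \<beta>(0,1)\<close> would be a counterexample.
\<close>

lemma inner_fund_below:
  assumes i: "i \<in> {1..n}" "0 < a i" "0 < b i"
    and E: "\<beta> \<in> E_Phi n a b" and pos: "0 < lookup \<beta> 0" "0 < lookup \<beta> (Suc 0)"
  shows "\<exists>\<gamma>\<in>inner_fund n a b. \<exists>\<delta>\<in>E_Phi n a b. \<beta> = \<gamma> + \<delta>"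
proof -
  let ?size = "\<lambda>\<gamma>. \<Sum>p<3 * n + 2. lookup \<gamma> p"
  let ?P = "\<lambda>\<gamma>. \<gamma> \<in> E_Phi n a b \<and> 0 < lookup \<gamma> 0 \<and> 0 < lookup \<gamma> (Suc 0) \<and> (\<exists>\<delta>\<in>E_Phi n a b. \<beta> = \<gamma> + \<delta>)"
  have zero: "0 \<in> E_Phi n a b" by (simp add: E_Phi_iff)
  then have "?P \<beta>" using E pos by (auto intro!: bexI[of _ 0])
  then obtain \<gamma> where P: "?P \<gamma>" and min: "\<And>\<gamma>'. ?P \<gamma>' \<Longrightarrow> ?size \<gamma> \<le> ?size \<gamma>'"
    using ex_has_least_nat[of ?P \<beta> ?size] by blast
  obtain \<delta> where \<delta>: "\<delta> \<in> E_Phi n a b" "\<beta> = \<gamma> + \<delta>" and \<gamma>: "\<gamma> \<in> E_Phi n a b" using P by blast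
  have size_pos: "0 < ?size \<epsilon>" if E': "\<epsilon> \<in> E_Phi n a b" and nz: "\<epsilon> \<noteq> 0" for \<epsilon>
  proof -
    obtain p where p: "lookup \<epsilon> p \<noteq> 0" using nz by (metis poly_mapping_eqI lookup_zero)
    then have "p < 3 * n + 2" using E_Phi_lookup_0[OF E', of p] by metis
    then show ?thesis using p by (intro sum_pos2[of _ p]) auto
  qed
  \<comment> \<open>By minimality, no proper part of the chosen vector has r and s positive.\<close>
  have no_part: "\<gamma>'' = 0" if "\<gamma>' \<in> E_Phi n a b" "\<gamma>'' \<in> E_Phi n a b" "\<gamma> = \<gamma>' + \<gamma>''"
    "0 < lookup \<gamma>' 0" "0 < lookup \<gamma>' (Suc 0)" for \<gamma>' \<gamma>''
  proof (rule ccontr)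
    assume "\<gamma>'' \<noteq> 0"
    have "\<beta> = \<gamma>' + (\<gamma>'' + \<delta>)" using \<delta> that by (simp add: add.assoc)
    then have "?P \<gamma>'" using that E_Phi_add[OF that(2) \<delta>(1)] by blast
    then have "?size \<gamma> \<le> ?size \<gamma>'" by (rule min)
    moreover have "?size \<gamma> = ?size \<gamma>' + ?size \<gamma>''" using that by (simp add: lookup_add sum.distrib)
    ultimately show False using size_pos[OF that(2) \<open>\<gamma>'' \<noteq> 0\<close>] by simp
  qed
  \<comment> \<open>Otherwise the vector \<open>\<alpha>\<close> of i could be split off.\<close>
  have corner: "lookup \<gamma> (3 * i - 1) = 0 \<or> lookup \<gamma> (3 * i) = 0"
  proof (rule ccontr)
    assume "\<not> ?thesis"
    then have hk: "0 < lookup \<gamma> (3 * i - 1)" "0 < lookup \<gamma> (3 * i)" by linarith+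
    note split = E_Phi_split_alpha[OF \<gamma> i(1) hk]
    have "\<gamma> = (\<gamma> - alpha_vec n i) + alpha_vec n i" using split(2) by (simp only: add.commute)
    moreover have "lookup (\<gamma> - alpha_vec n i) 0 = lookup \<gamma> 0"
      "lookup (\<gamma> - alpha_vec n i) (Suc 0) = lookup \<gamma> (Suc 0)"
      unfolding lookup_minus alpha_vec_def lookup_mk_vec_coords by simp_all
    ultimately have "alpha_vec n i = 0"
      using no_part[OF split(1) alpha_in_E_Phi] P by metis
    then show False using alpha_vec_nonzero[OF i(1)] by blast
  qed
  \<comment> \<open>A part with s = 0 has positive k at i, a part with r = 0 has positive h at i; their sum would have neither slack zero.\<close>
  have mixed: False if g: "\<gamma>' \<in> E_Phi n a b" "\<gamma>'' \<in> E_Phi n a b" "\<gamma> = \<gamma>' + \<gamma>''"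
    "lookup \<gamma>' 0 = 0" "lookup \<gamma>'' (Suc 0) = 0" for \<gamma>' \<gamma>''
  proof -
    have "0 < lookup \<gamma>'' 0" "0 < lookup \<gamma>' (Suc 0)" using P g by (auto simp: lookup_add)
    then have pos: "0 < a i * lookup \<gamma>'' 0" "0 < b i * lookup \<gamma>' (Suc 0)" using i(2,3) by simp_all
    have "0 < lookup \<gamma>'' (3 * i)" "0 < lookup \<gamma>' (3 * i - 1)"
      using pos E_Phi_eqs[OF g(1) i(1)] E_Phi_eqs[OF g(2) i(1)] unfolding g(4,5) by linarith+
    then show False using corner unfolding g(3) lookup_add by linarith
  qed
  have "\<gamma>' = \<gamma> \<or> \<gamma>'' = \<gamma>" if g: "\<gamma>' \<in> E_Phi n a b" "\<gamma>'' \<in> E_Phi n a b" "\<gamma> = \<gamma>' + \<gamma>''" for \<gamma>' \<gamma>''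
  proof -
    consider "0 < lookup \<gamma>' 0" "0 < lookup \<gamma>' (Suc 0)" | "0 < lookup \<gamma>'' 0" "0 < lookup \<gamma>'' (Suc 0)"
      | "lookup \<gamma>' 0 = 0" "lookup \<gamma>'' (Suc 0) = 0" | "lookup \<gamma>'' 0 = 0" "lookup \<gamma>' (Suc 0) = 0"
      using P g by (fastforce simp: lookup_add)
    then show ?thesis
    proof cases
      case 1 then show ?thesis using no_part g by simp
    next
      case 2 then show ?thesis using no_part[of \<gamma>'' \<gamma>'] g by (simp add: add.commute)
    next
      case 3 then show ?thesis using mixed g by blast
    next
      case 4 then show ?thesis using mixed[of \<gamma>'' \<gamma>'] g by (simp add: add.commute)
    qed
  qed
  then have "\<gamma> \<in> FUND n a b" using P by (auto simp: FUND_def)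
  moreover have "\<gamma> \<notin> alpha_vec n ` {1..n} \<union> {beta_vec n a b 1 0, beta_vec n a b 0 1}"
    using P by (auto simp: alpha_vec_def beta_vec_def lookup_mk_vec_coords(1,2))
  ultimately show ?thesis using \<delta> by blast
qed

section \<open>Powers of principal monomial ideals\<close>

lemma sum_single_lookup: "(\<Sum>k\<in>keys p. Poly_Mapping.single k (lookup p k)) = p"
proof (rule poly_mapping_eqI)
  fix k
  have "lookup (\<Sum>k\<in>keys p. Poly_Mapping.single k (lookup p k)) k = (\<Sum>j\<in>keys p. if k = j then lookup p j else 0)"
    unfolding lookup_sum lookup_single when_def by (rule sum.cong) auto
  also have "\<dots> = lookup p k" by (simp add: in_keys_iff)
  finally show "lookup (\<Sum>k\<in>keys p. Poly_Mapping.single k (lookup p k)) k = lookup p k" .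
qed

lemma single_sum: "Poly_Mapping.single k (sum f A) = (\<Sum>x\<in>A. Poly_Mapping.single k (f x))"
  by (induction A rule: infinite_finite_induct) (simp_all add: single_add)

lemma sum_closed:
  assumes "Q 0" "\<And>x y. Q x \<Longrightarrow> Q y \<Longrightarrow> Q (x + y)" "\<And>x. x \<in> A \<Longrightarrow> Q (f x)"
  shows "Q (sum f A)"
  using assms(3) by (induction A rule: infinite_finite_induct) (auto intro: assms(1,2))

lemma lookup_exponent: "lookup (exponent n e) i = (if i \<in> {1..n} then e i else 0)"
proof -
  have "lookup (exponent n e) i = (\<Sum>j=1..n. if i = j then e j else 0)"
    unfolding exponent_def lookup_sum lookup_single when_def by (rule sum.cong) auto
  then show ?thesis by simp
qed

lemma exponent_add: "exponent n (\<lambda>i. f i + g i) = exponent n f + exponent n g"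
  by (simp add: exponent_def single_add sum.distrib)

lemma keys_exponent: "keys (exponent n e) \<subseteq> {1..n}"
  by (auto simp: in_keys_iff lookup_exponent split: if_splits)

lemma exponent_lookup: "keys m \<subseteq> {1..n} \<Longrightarrow> exponent n (lookup m) = m"
  by (rule poly_mapping_eqI) (auto simp: lookup_exponent in_keys_iff)

definition monomial_ideal :: "nat \<Rightarrow> (nat \<Rightarrow> nat) \<Rightarrow> ((nat \<Rightarrow>\<^sub>0 nat) \<Rightarrow>\<^sub>0 'k::field) set" where
  "monomial_ideal n e =
     {p. \<forall>m\<in>keys p. keys m \<subseteq> {1..n} \<and> (\<forall>i\<in>{1..n}. e i \<le> lookup m i)}"

lemma monomial_ideal_0: "0 \<in> monomial_ideal n e"
  by (simp add: monomial_ideal_def)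

lemma monomial_ideal_add:
  "p \<in> monomial_ideal n e \<Longrightarrow> q \<in> monomial_ideal n e \<Longrightarrow> p + q \<in> monomial_ideal n e"
  using keys_add[of p q] unfolding monomial_ideal_def by blast

lemma monomial_ideal_mult:
  assumes "p \<in> monomial_ideal n c" "q \<in> monomial_ideal n d"
  shows "p * q \<in> monomial_ideal n (\<lambda>i. c i + d i)"
  unfolding monomial_ideal_def
proof (intro CollectI ballI conjI)
  fix m assume "m \<in> keys (p * q)"
  then obtain m1 m2 where m: "m = m1 + m2" "m1 \<in> keys p" "m2 \<in> keys q"
    using keys_mult[of p q] by blast
  then have *: "keys m1 \<subseteq> {1..n}" "keys m2 \<subseteq> {1..n}"
     "\<And>i. i \<in> {1..n} \<Longrightarrow> c i \<le> lookup m1 i" "\<And>i. i \<in> {1..n} \<Longrightarrow> d i \<le> lookup m2 i"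
    using assms unfolding monomial_ideal_def by blast+
  show "keys m \<subseteq> {1..n}" using *(1,2) keys_add[of m1 m2] m(1) by blast
  show "c i + d i \<le> lookup m i" if "i \<in> {1..n}" for i
    using *(3,4)[OF that] m(1) by (simp add: lookup_add)
qed

text \<open>
  Dividing each monomial of p by \<open>x^d\<close>. With c = 0 this shows that monomial ideals of this kind are
  principal, and in general it yields the product of two of them.
\<close>

lemma monomial_ideal_factor:
  assumes "p \<in> monomial_ideal n (\<lambda>i. c i + d i)"
  shows "\<exists>q\<in>monomial_ideal n c. p = q * monomial (exponent n d)"
proof
  let ?e = "exponent n d"
  define q where "q = (\<Sum>m\<in>keys p. Poly_Mapping.single (m - ?e) (lookup p m))"
  have m: "keys m \<subseteq> {1..n}" "\<And>i. i \<in> {1..n} \<Longrightarrow> c i + d i \<le> lookup m i" if "m \<in> keys p" for m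
    using assms that unfolding monomial_ideal_def by blast+
  have split: "m - ?e + ?e = m" if "m \<in> keys p" for m
    by (rule poly_mapping_eqI) (use m(2)[OF that] in \<open>force simp: lookup_add lookup_minus lookup_exponent\<close>)
  have "q * monomial ?e = (\<Sum>m\<in>keys p. Poly_Mapping.single (m - ?e + ?e) (lookup p m))"
    by (simp add: q_def monomial_def sum_distrib_right mult_single)
  also have "\<dots> = (\<Sum>m\<in>keys p. Poly_Mapping.single m (lookup p m))"
    by (rule sum.cong) (simp_all add: split)
  finally show "p = q * monomial ?e" by (simp add: sum_single_lookup)
  show "q \<in> monomial_ideal n c"
    unfolding q_def
  proof (rule sum_closed[where Q = "\<lambda>p. p \<in> monomial_ideal n c"])
    fix m' assume m': "m' \<in> keys p"
    have "keys (m' - ?e) \<subseteq> {1..n}"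
      using m(1)[OF m'] by (auto simp: in_keys_iff lookup_minus)
    moreover have "c i \<le> lookup (m' - ?e) i" if "i \<in> {1..n}" for i
      using m(2)[OF m' that] that by (simp add: lookup_minus lookup_exponent)
    ultimately show "Poly_Mapping.single (m' - ?e) (lookup p m') \<in> monomial_ideal n c"
      by (simp add: monomial_ideal_def)
  qed (auto intro: monomial_ideal_0 monomial_ideal_add)
qed

lemma monomial_in_monomial_ideal: "monomial (exponent n d) \<in> monomial_ideal n d"
  using keys_exponent[of n d] by (simp add: monomial_ideal_def monomial_def lookup_exponent)

lemma carrier_poly_ring: "carrier (poly_ring n) = monomial_ideal n (\<lambda>_. 0)"
  by (simp add: poly_ring_def sub_ring_def monomial_ideal_def)

lemma PIdl_monomial: "PIdl\<^bsub>poly_ring n\<^esub> (monomial (exponent n d)) = monomial_ideal n d"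
proof -
  have "PIdl\<^bsub>poly_ring n\<^esub> (monomial (exponent n d))
      = {q * monomial (exponent n d) | q. q \<in> monomial_ideal n (\<lambda>_. 0)}"
    unfolding cgenideal_def carrier_poly_ring by (simp add: poly_ring_def sub_ring_def)
  also have "\<dots> = monomial_ideal n d"
    using monomial_ideal_mult[OF _ monomial_in_monomial_ideal, of _ n "\<lambda>_. 0" d]
      monomial_ideal_factor[of _ n "\<lambda>_. 0" d] by auto
  finally show ?thesis .
qed

lemma ideal_prod_monomial_ideal:
  "ideal_prod (poly_ring n) (monomial_ideal n c) (monomial_ideal n d)
     = (monomial_ideal n (\<lambda>i. c i + d i) :: ((nat \<Rightarrow>\<^sub>0 nat) \<Rightarrow>\<^sub>0 'k::field) set)" (is "?L = ?R")
proof
  have ops: "x \<otimes>\<^bsub>poly_ring n\<^esub> y = x * y" "x \<oplus>\<^bsub>poly_ring n\<^esub> y = x + y" for x y :: "(nat \<Rightarrow>\<^sub>0 nat) \<Rightarrow>\<^sub>0 'k"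
    by (simp_all add: poly_ring_def sub_ring_def)
  show "?L \<subseteq> ?R"
  proof
    fix p :: "(nat \<Rightarrow>\<^sub>0 nat) \<Rightarrow>\<^sub>0 'k"
    assume "p \<in> ?L"
    then show "p \<in> ?R"
      by (induction rule: ideal_prod.induct)
        (simp_all add: ops monomial_ideal_mult monomial_ideal_add)
  qed
  show "?R \<subseteq> ?L"
  proof
    fix p :: "(nat \<Rightarrow>\<^sub>0 nat) \<Rightarrow>\<^sub>0 'k" assume "p \<in> ?R"
    then obtain q where q: "q \<in> monomial_ideal n c" "p = q * monomial (exponent n d)"
      using monomial_ideal_factor by blast
    show "p \<in> ?L"
      using ideal_prod.prod[OF q(1) monomial_in_monomial_ideal[of n d], of "poly_ring n"]
      by (simp add: ops q(2))
  qed
qed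

lemma monomial_ideal_pow:
  "(monomial_ideal n d :: ((nat \<Rightarrow>\<^sub>0 nat) \<Rightarrow>\<^sub>0 'k::field) set) [^]\<^bsub>ideals_set (poly_ring n)\<^esub> r
     = monomial_ideal n (\<lambda>i. r * d i)" (is "?I [^]\<^bsub>_\<^esub> _ = _")
proof (induction r)
  case 0
  then show ?case by (simp add: nat_pow_def ideals_set_def carrier_poly_ring)
next
  case (Suc r)
  have "?I [^]\<^bsub>ideals_set (poly_ring n)\<^esub> Suc r
      = ideal_prod (poly_ring n) (?I [^]\<^bsub>ideals_set (poly_ring n)\<^esub> r) ?I"
    by (simp add: nat_pow_def ideals_set_def)
  then show ?case
    by (simp only: Suc ideal_prod_monomial_ideal) (simp add: add.commute)
qed

section \<open>Polynomials with prescribed supports\<close>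

text \<open>
  Polynomials in u and v over a polynomial ring, all of whose monomials have their pair of exponents
  in a given relation. The intersection algebra and its canonical module are both of this form.
\<close>

definition supported_on :: "('i \<Rightarrow> 'j \<Rightarrow> bool) \<Rightarrow> ('i \<Rightarrow>\<^sub>0 ('j \<Rightarrow>\<^sub>0 'k::field)) set" where
  "supported_on P = {f. \<forall>k. \<forall>m\<in>keys (lookup f k). P k m}"

abbreviation uv_term :: "'i \<Rightarrow> 'j \<Rightarrow> 'k \<Rightarrow> ('i \<Rightarrow>\<^sub>0 ('j \<Rightarrow>\<^sub>0 'k::field))" where
  "uv_term k m c \<equiv> Poly_Mapping.single k (Poly_Mapping.single m c)"

lemma supported_on_0: "0 \<in> supported_on P"
  by (simp add: supported_on_def)

lemma supported_on_add: "f \<in> supported_on P \<Longrightarrow> g \<in> supported_on P \<Longrightarrow> f + g \<in> supported_on P"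
  by (auto simp: supported_on_def lookup_add dest!: subsetD[OF keys_add])

lemma supported_on_uminus: "f \<in> supported_on P \<Longrightarrow> - f \<in> supported_on P"
  by (simp add: supported_on_def in_keys_iff)

lemma supported_on_uv_term: "P k m \<Longrightarrow> uv_term k m c \<in> supported_on P"
  by (simp add: supported_on_def lookup_single when_def)

lemma supported_on_mono: "(\<And>k m. P k m \<Longrightarrow> Q k m) \<Longrightarrow> supported_on P \<subseteq> supported_on Q"
  unfolding supported_on_def by blast

lemma supported_on_induct [consumes 1, case_names zero add uv_term]:
  assumes "f \<in> supported_on P" and "Q 0" and "\<And>f g. Q f \<Longrightarrow> Q g \<Longrightarrow> Q (f + g)"
    and "\<And>k m c. P k m \<Longrightarrow> Q (uv_term k m c)"
  shows "Q f"
proof -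
  have "f = (\<Sum>k\<in>keys f. Poly_Mapping.single k (\<Sum>m\<in>keys (lookup f k). Poly_Mapping.single m (lookup (lookup f k) m)))"
    unfolding sum_single_lookup ..
  also have "Q \<dots>"
    unfolding single_sum using assms(1)
    by (intro sum_closed[where Q = Q] assms) (auto simp: supported_on_def)
  finally show ?thesis .
qed

lemma supported_on_mult:
  fixes f g :: "'i::comm_monoid_add \<Rightarrow>\<^sub>0 ('j::comm_monoid_add \<Rightarrow>\<^sub>0 'k::field)"
  assumes f: "f \<in> supported_on P" and g: "g \<in> supported_on Q"
    and PQ: "\<And>k m k' m'. P k m \<Longrightarrow> Q k' m' \<Longrightarrow> R (k + k') (m + m')"
  shows "f * g \<in> supported_on R"
  using f
proof (induction rule: supported_on_induct)
  case (uv_term k m c)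
  show ?case using g
  proof (induction rule: supported_on_induct)
    case (uv_term k' m' c')
    then show ?case
      using \<open>P k m\<close> by (simp add: mult_single supported_on_uv_term PQ)
  qed (simp_all add: supported_on_0 supported_on_add distrib_left)
qed (simp_all add: supported_on_0 supported_on_add distrib_right)

section \<open>The intersection algebra and the ideal of interior monomials\<close>

lemma ring_sub_ring:
  fixes A :: "'r::comm_ring_1 set"
  assumes "0 \<in> A" "1 \<in> A" "\<And>x y. x \<in> A \<Longrightarrow> y \<in> A \<Longrightarrow> x + y \<in> A" "\<And>x. x \<in> A \<Longrightarrow> - x \<in> A"
    "\<And>x y. x \<in> A \<Longrightarrow> y \<in> A \<Longrightarrow> x * y \<in> A"
  shows "ring (sub_ring A)"
proof (rule ringI)
  show "abelian_group (sub_ring A)"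
    by (rule abelian_groupI) (auto simp: sub_ring_def assms algebra_simps intro: bexI[of _ "- x" for x])
  show "Group.monoid (sub_ring A)"
    by (rule Group.monoidI) (auto simp: sub_ring_def assms algebra_simps)
qed (auto simp: sub_ring_def algebra_simps)

lemma ideal_sub_ring:
  fixes A I :: "'r::comm_ring_1 set"
  assumes "ring (sub_ring A)" "I \<subseteq> A" "0 \<in> I" "\<And>x y. x \<in> I \<Longrightarrow> y \<in> I \<Longrightarrow> x + y \<in> I"
    "\<And>x. x \<in> I \<Longrightarrow> - x \<in> I" "\<And>x y. x \<in> A \<Longrightarrow> y \<in> I \<Longrightarrow> x * y \<in> I"
  shows "ideal I (sub_ring A)"
proof (rule idealI)
  interpret ring "sub_ring A" by (rule assms(1))
  have inv: "inv\<^bsub>add_monoid (sub_ring A)\<^esub> x = - x" if "x \<in> I" for x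
  proof -
    have "\<ominus>\<^bsub>sub_ring A\<^esub> x = - x"
      by (rule minus_equality) (use that assms in \<open>auto simp: sub_ring_def\<close>)
    then show ?thesis by (simp add: a_inv_def)
  qed
  show "subgroup I (add_monoid (sub_ring A))"
    by (rule subgroup.intro) (use assms inv in \<open>auto simp: sub_ring_def\<close>)
  fix x y assume "x \<in> I" "y \<in> carrier (sub_ring A)"
  then have "y * x \<in> I" by (simp add: assms(6) sub_ring_def)
  then show "y \<otimes>\<^bsub>sub_ring A\<^esub> x \<in> I" "x \<otimes>\<^bsub>sub_ring A\<^esub> y \<in> I"
    by (simp_all add: sub_ring_def mult.commute)
qed (rule assms(1))

text \<open>
  The pair k consists of the exponents of u and v, and m is the exponent of the remaining monomial.
\<close>

definition in_cone :: "nat \<Rightarrow> (nat \<Rightarrow> nat) \<Rightarrow> (nat \<Rightarrow> nat) \<Rightarrow> nat \<times> nat \<Rightarrow> (nat \<Rightarrow>\<^sub>0 nat) \<Rightarrow> bool" where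
  "in_cone n a b k m \<longleftrightarrow> keys m \<subseteq> {1..n} \<and>
     (\<forall>i\<in>{1..n}. fst k * a i \<le> lookup m i \<and> snd k * b i \<le> lookup m i)"

definition in_interior :: "nat \<Rightarrow> (nat \<Rightarrow> nat) \<Rightarrow> (nat \<Rightarrow> nat) \<Rightarrow> nat \<times> nat \<Rightarrow> (nat \<Rightarrow>\<^sub>0 nat) \<Rightarrow> bool" where
  "in_interior n a b k m \<longleftrightarrow> 0 < fst k \<and> 0 < snd k \<and> keys m \<subseteq> {1..n} \<and>
     (\<forall>i\<in>{1..n}. fst k * a i < lookup m i \<and> snd k * b i < lookup m i)"

lemma principal_intersection_algebra_eq:
  "(principal_intersection_algebra n a b :: (nat \<times> nat \<Rightarrow>\<^sub>0 ((nat \<Rightarrow>\<^sub>0 nat) \<Rightarrow>\<^sub>0 'k::field)) ring)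
     = sub_ring (supported_on (in_cone n a b))"
proof -
  have eq: "(\<forall>r s. lookup f (r, s) \<in> monomial_ideal n (\<lambda>i. r * a i) \<inter> monomial_ideal n (\<lambda>i. s * b i))
      \<longleftrightarrow> f \<in> supported_on (in_cone n a b)" for f :: "nat \<times> nat \<Rightarrow>\<^sub>0 ((nat \<Rightarrow>\<^sub>0 nat) \<Rightarrow>\<^sub>0 'k)"
    unfolding supported_on_def in_cone_def monomial_ideal_def by fastforce
  show ?thesis
    unfolding principal_intersection_algebra_def intersection_algebra_def PIdl_monomial monomial_ideal_pow eq
    by simp
qed

lemma in_cone_add:
  assumes "in_cone n a b k m" "in_cone n a b k' m'"
  shows "in_cone n a b (k + k') (m + m')"
  using assms keys_add[of m m'] unfolding in_cone_def
  by (auto simp: lookup_add distrib_right intro: add_mono)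

lemma in_interior_add:
  assumes "in_cone n a b k m" "in_interior n a b k' m'"
  shows "in_interior n a b (k + k') (m + m')"
  using assms keys_add[of m m'] unfolding in_cone_def in_interior_def
  by (auto simp: lookup_add distrib_right intro: add_le_less_mono)

lemma in_interior_in_cone: "in_interior n a b k m \<Longrightarrow> in_cone n a b k m"
  unfolding in_cone_def in_interior_def by auto

lemma ring_intersection_algebra: "ring (principal_intersection_algebra n a b)"
  unfolding principal_intersection_algebra_eq
proof (rule ring_sub_ring)
  have "uv_term 0 0 1 \<in> supported_on (in_cone n a b)"
    by (rule supported_on_uv_term) (simp add: in_cone_def)
  then show "1 \<in> supported_on (in_cone n a b)" by simp
qed (auto intro: supported_on_0 supported_on_add supported_on_uminus supported_on_mult in_cone_add)

lemma ideal_supported_on_interior: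
  "ideal (supported_on (in_interior n a b)) (principal_intersection_algebra n a b)"
  using ring_intersection_algebra unfolding principal_intersection_algebra_eq
  by (rule ideal_sub_ring)
    (auto intro: supported_on_0 supported_on_add supported_on_uminus supported_on_mult in_interior_add
      subsetD[OF supported_on_mono[OF in_interior_in_cone]])

section \<open>The canonical module\<close>

abbreviation uv_exp :: "(nat \<Rightarrow>\<^sub>0 nat) \<Rightarrow> nat \<times> nat" where
  "uv_exp \<beta> \<equiv> (lookup \<beta> 0, lookup \<beta> (Suc 0))"

abbreviation x_exp :: "nat \<Rightarrow> (nat \<Rightarrow>\<^sub>0 nat) \<Rightarrow> (nat \<Rightarrow>\<^sub>0 nat)" where
  "x_exp n \<beta> \<equiv> exponent n (\<lambda>i. lookup \<beta> (3 * i + 1))"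

abbreviation E_Phi_interior :: "nat \<Rightarrow> (nat \<Rightarrow> nat) \<Rightarrow> (nat \<Rightarrow> nat) \<Rightarrow> (nat \<Rightarrow>\<^sub>0 nat) set" where
  "E_Phi_interior n a b \<equiv> {\<beta> \<in> E_Phi n a b. \<forall>j<3 * n + 2. 0 < lookup \<beta> j}"

lemma to_B_eq:
  assumes "finite S" "keys p \<subseteq> S"
  shows "to_B n p = (\<Sum>\<beta>\<in>S. uv_term (uv_exp \<beta>) (x_exp n \<beta>) (lookup p \<beta>))"
  unfolding to_B_def One_nat_def
  by (rule sum.mono_neutral_left[OF assms]) (simp add: in_keys_iff)

lemma to_B_single: "to_B n (Poly_Mapping.single \<beta> c) = uv_term (uv_exp \<beta>) (x_exp n \<beta>) c"
  by (subst to_B_eq[of "{\<beta>}"]) simp_all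

lemma to_B_0: "to_B n 0 = 0"
  by (simp add: to_B_def)

lemma to_B_add: "to_B n (p + q) = to_B n p + to_B n q"
proof -
  let ?S = "keys p \<union> keys q"
  have "to_B n (p + q) = (\<Sum>\<beta>\<in>?S. uv_term (uv_exp \<beta>) (x_exp n \<beta>) (lookup (p + q) \<beta>))"
    by (rule to_B_eq) (simp_all add: keys_add)
  also have "\<dots> = to_B n p + to_B n q"
    by (simp add: to_B_eq[of ?S p] to_B_eq[of ?S q] lookup_add single_add sum.distrib)
  finally show ?thesis .
qed

text \<open>
  The map is multiplicative on monomials, so divisibility of exponents carries over to the
  intersection algebra.
\<close>

lemma to_B_single_add:
  "to_B n (Poly_Mapping.single (\<beta> + \<gamma>) (c * d)) = to_B n (Poly_Mapping.single \<beta> c) * to_B n (Poly_Mapping.single \<gamma> d)"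
  unfolding to_B_single lookup_add exponent_add by (simp add: mult_single)

lemma in_cone_of_E_Phi:
  assumes "\<beta> \<in> E_Phi n a b"
  shows "in_cone n a b (uv_exp \<beta>) (x_exp n \<beta>)"
  unfolding in_cone_def
proof (intro conjI ballI keys_exponent)
  fix i assume i: "i \<in> {1..n}"
  show "fst (uv_exp \<beta>) * a i \<le> lookup (x_exp n \<beta>) i" "snd (uv_exp \<beta>) * b i \<le> lookup (x_exp n \<beta>) i"
    using E_Phi_eqs[OF assms i] i by (simp_all only: lookup_exponent fst_conv snd_conv mult.commute if_True)
qed

text \<open>
  The slack h is the gap in the inequality \<open>r a i \<le> m i\<close>, and k the gap in \<open>s b i \<le> m i\<close>; positive
  slacks make these inequalities strict.
\<close>

lemma in_interior_of_E_Phi_interior: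
  assumes "\<beta> \<in> E_Phi_interior n a b"
  shows "in_interior n a b (uv_exp \<beta>) (x_exp n \<beta>)"
  unfolding in_interior_def
proof (intro conjI ballI keys_exponent)
  have E: "\<beta> \<in> E_Phi n a b" and pos: "\<And>j. j < 3 * n + 2 \<Longrightarrow> 0 < lookup \<beta> j" using assms by blast+
  show "0 < fst (uv_exp \<beta>)" "0 < snd (uv_exp \<beta>)" using pos by simp_all
  fix i assume i: "i \<in> {1..n}"
  then have "3 * i - 1 < 3 * n + 2" "3 * i < 3 * n + 2" by auto
  then have "0 < lookup \<beta> (3 * i - 1)" "0 < lookup \<beta> (3 * i)" using pos by blast+
  then show "fst (uv_exp \<beta>) * a i < lookup (x_exp n \<beta>) i" "snd (uv_exp \<beta>) * b i < lookup (x_exp n \<beta>) i"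
    using E_Phi_eqs[OF E i] i by (simp_all only: lookup_exponent fst_conv snd_conv mult.commute if_True)
qed

text \<open>
  The slacks can be recovered from r, s and m, so every monomial satisfying the strict inequalities
  comes from the canonical ideal.
\<close>

lemma E_Phi_interior_surj:
  assumes "in_interior n a b k m"
  obtains \<beta> where "\<beta> \<in> E_Phi_interior n a b" "uv_exp \<beta> = k" "x_exp n \<beta> = m"
proof
  let ?\<beta> = "mk_vec n (fst k) (snd k) (\<lambda>i. lookup m i - a i * fst k) (\<lambda>i. lookup m i - b i * snd k) (lookup m)"
  have m: "0 < fst k" "0 < snd k" "keys m \<subseteq> {1..n}"
      "\<And>i. i \<in> {1..n} \<Longrightarrow> a i * fst k < lookup m i" "\<And>i. i \<in> {1..n} \<Longrightarrow> b i * snd k < lookup m i"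
    using assms unfolding in_interior_def by (simp_all add: mult.commute)
  show "uv_exp ?\<beta> = k" by (simp add: lookup_mk_vec_coords)
  have "x_exp n ?\<beta> = exponent n (lookup m)"
    unfolding exponent_def by (rule sum.cong) (simp_all only: lookup_mk_vec_coords)
  then show "x_exp n ?\<beta> = m" using exponent_lookup[OF m(3)] by simp
  have "?\<beta> \<in> E_Phi n a b"
    by (rule mk_vec_in_E_PhiI) (simp_all add: m less_imp_le)
  moreover have "0 < lookup ?\<beta> j" if "j < 3 * n + 2" for j
    using that
  proof (cases rule: coords_cases)
    case (5 i)
    then show ?thesis using m(4)[OF 5(1)] by (simp only: lookup_mk_vec_coords)
  qed (simp_all only: lookup_mk_vec_coords m zero_less_diff)
  ultimately show "?\<beta> \<in> E_Phi_interior n a b" by blast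
qed

lemma module_poly: "Modules.module (\<lambda>c p. Poly_Mapping.single (0::nat \<Rightarrow>\<^sub>0 nat) c * (p :: (nat \<Rightarrow>\<^sub>0 nat) \<Rightarrow>\<^sub>0 'k::field))"
  by standard (simp_all add: single_add mult_single algebra_simps)

lemma canonical_ideal_0: "0 \<in> canonical_ideal n a b"
  unfolding canonical_ideal_def k_span_def by (rule Modules.module.span_zero[OF module_poly])

lemma canonical_ideal_add:
  "p \<in> canonical_ideal n a b \<Longrightarrow> q \<in> canonical_ideal n a b \<Longrightarrow> p + q \<in> canonical_ideal n a b"
  unfolding canonical_ideal_def k_span_def by (rule Modules.module.span_add[OF module_poly])

lemma single_in_canonical_ideal:
  fixes c :: "'k::field"
  assumes "\<beta> \<in> E_Phi_interior n a b"
  shows "Poly_Mapping.single \<beta> c \<in> canonical_ideal n a b"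
proof -
  have "Poly_Mapping.single 0 c * monomial \<beta> \<in> canonical_ideal n a b"
    unfolding canonical_ideal_def k_span_def
    by (intro Modules.module.span_scale[OF module_poly] Modules.module.span_base[OF module_poly] imageI assms)
  then show ?thesis by (simp add: monomial_def mult_single)
qed

lemma canonical_ideal_induct [consumes 1, case_names zero add]:
  fixes p :: "(nat \<Rightarrow>\<^sub>0 nat) \<Rightarrow>\<^sub>0 'k::field"
  assumes "p \<in> canonical_ideal n a b" "Q 0"
    and "\<And>\<beta> c p. \<beta> \<in> E_Phi_interior n a b \<Longrightarrow> Q p \<Longrightarrow> Q (Poly_Mapping.single \<beta> c + p)"
  shows "Q p"
  using assms(1) unfolding canonical_ideal_def k_span_def
proof (induction rule: Modules.module.span_induct_alt[OF module_poly, consumes 1, case_names base step])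
  case (step c x y)
  then obtain \<beta> where "\<beta> \<in> E_Phi_interior n a b" "x = monomial \<beta>" by blast
  then show ?case using assms(3)[of \<beta> y c] step by (simp add: monomial_def mult_single)
qed (rule assms(2))

lemma canonical_module_eq:
  "(canonical_module n a b :: (nat \<times> nat \<Rightarrow>\<^sub>0 ((nat \<Rightarrow>\<^sub>0 nat) \<Rightarrow>\<^sub>0 'k::field)) set) = supported_on (in_interior n a b)"
  (is "?M = ?S")
proof
  show "?M \<subseteq> ?S"
  proof
    fix f :: "nat \<times> nat \<Rightarrow>\<^sub>0 ((nat \<Rightarrow>\<^sub>0 nat) \<Rightarrow>\<^sub>0 'k)" assume "f \<in> ?M"
    then obtain p where p: "p \<in> canonical_ideal n a b" and f: "f = to_B n p"
      unfolding canonical_module_def by blast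
    from p have "to_B n p \<in> ?S"
    proof (induction rule: canonical_ideal_induct)
      case (add \<beta> c p)
      then show ?case unfolding to_B_add to_B_single
        by (intro supported_on_add supported_on_uv_term in_interior_of_E_Phi_interior)
    qed (simp add: to_B_0 supported_on_0)
    then show "f \<in> ?S" unfolding f .
  qed
  show "?S \<subseteq> ?M"
  proof
    fix f :: "nat \<times> nat \<Rightarrow>\<^sub>0 ((nat \<Rightarrow>\<^sub>0 nat) \<Rightarrow>\<^sub>0 'k)" assume "f \<in> ?S"
    then show "f \<in> ?M"
    proof (induction rule: supported_on_induct)
      case zero
      show ?case unfolding canonical_module_def using canonical_ideal_0 to_B_0 by (metis image_eqI)
    next
      case (add f g)
      then obtain p q where "p \<in> canonical_ideal n a b" "q \<in> canonical_ideal n a b"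
        and fg: "f = to_B n p" "g = to_B n q"
        unfolding canonical_module_def by blast
      then have "p + q \<in> canonical_ideal n a b" by (intro canonical_ideal_add)
      then show ?case unfolding canonical_module_def fg to_B_add[symmetric] by (rule imageI)
    next
      case (uv_term k m c)
      then obtain \<beta> where \<beta>: "\<beta> \<in> E_Phi_interior n a b" "uv_exp \<beta> = k" "x_exp n \<beta> = m"
        by (rule E_Phi_interior_surj)
      then have "uv_term k m c = to_B n (Poly_Mapping.single \<beta> c)" by (simp only: to_B_single)
      then show ?case unfolding canonical_module_def using single_in_canonical_ideal[OF \<beta>(1)] by blast
    qed
  qed
qed

section \<open>Generation\<close>

lemma canonical_generators_eq:
  "canonical_generators n a b = (\<lambda>\<gamma>. \<gamma> + ones n) ` inner_fund n a b"
  unfolding canonical_generators_def by blast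

lemma canonical_generators_interior: "canonical_generators n a b \<subseteq> E_Phi_interior n a b"
proof
  fix g assume "g \<in> canonical_generators n a b"
  then obtain \<gamma> where \<gamma>: "\<gamma> \<in> inner_fund n a b" and g: "g = \<gamma> + ones n"
    unfolding canonical_generators_eq by blast
  have "g \<in> E_Phi n a b"
    unfolding g using \<gamma> by (intro E_Phi_add ones_in_E_Phi FUND_E) blast
  moreover have "0 < lookup g j" if "j < 3 * n + 2" for j
    using that unfolding g lookup_add
    by (cases rule: coords_cases)
      (simp_all only: lookup_mk_vec_coords inner_fund_uv_pos[OF \<gamma>] add_pos_nonneg add_nonneg_pos zero_le zero_less_one)
  ultimately show "g \<in> E_Phi_interior n a b" by blast
qed

text \<open>
  Positive slacks allow (0, 0, 1, ..., 1) to be subtracted, and r and s stay positive, so a kept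
  fundamental vector splits off from what remains.
\<close>

lemma E_Phi_interior_factor:
  assumes i: "i \<in> {1..n}" "0 < a i" "0 < b i" and \<beta>: "\<beta> \<in> E_Phi_interior n a b"
  shows "\<exists>g\<in>canonical_generators n a b. \<exists>\<delta>\<in>E_Phi n a b. \<beta> = g + \<delta>"
proof -
  have E: "\<beta> \<in> E_Phi n a b" and pos: "\<And>j. j < 3 * n + 2 \<Longrightarrow> 0 < lookup \<beta> j" using \<beta> by blast+
  have uv: "lookup (ones n) 0 \<le> lookup \<beta> 0" "lookup (ones n) (Suc 0) \<le> lookup \<beta> (Suc 0)"
    by (simp_all only: lookup_mk_vec_coords le0)
  have h: "lookup (ones n) (3 * j - 1) \<le> lookup \<beta> (3 * j - 1)"
    and k: "lookup (ones n) (3 * j) \<le> lookup \<beta> (3 * j)" if j: "j \<in> {1..n}" for j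
  proof -
    have "3 * j - 1 < 3 * n + 2" "3 * j < 3 * n + 2" using j by auto
    then have "0 < lookup \<beta> (3 * j - 1)" "0 < lookup \<beta> (3 * j)" using pos by blast+
    then show "lookup (ones n) (3 * j - 1) \<le> lookup \<beta> (3 * j - 1)" "lookup (ones n) (3 * j) \<le> lookup \<beta> (3 * j)"
      unfolding lookup_mk_vec_coords(3,4)[OF j] by linarith+
  qed
  let ?\<beta>' = "\<beta> - ones n"
  have E': "?\<beta>' \<in> E_Phi n a b" by (rule E_Phi_split(1)[OF E ones_in_E_Phi uv h k])
  have eq: "\<beta> = ones n + ?\<beta>'" by (rule E_Phi_split(2)[OF E ones_in_E_Phi uv h k])
  have "0 < lookup ?\<beta>' 0" "0 < lookup ?\<beta>' (Suc 0)"
    using pos[of 0] pos[of "Suc 0"] by (simp_all add: lookup_minus lookup_mk_vec_coords)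
  then obtain \<gamma> \<delta> where "\<gamma> \<in> inner_fund n a b" "\<delta> \<in> E_Phi n a b" "?\<beta>' = \<gamma> + \<delta>"
    using inner_fund_below[OF i E'] by blast
  moreover from this eq have "\<beta> = (\<gamma> + ones n) + \<delta>" by (simp add: ac_simps)
  ultimately show ?thesis unfolding canonical_generators_eq by blast
qed

theorem corollary2p17:
  fixes n :: nat and a b :: "nat \<Rightarrow> nat"
  assumes "fan_ordered n a b"
    and "\<exists>i\<in>{1..n}. 0 < a i \<and> 0 < b i"
  shows "(canonical_module n a b :: (nat \<times> nat \<Rightarrow>\<^sub>0 ((nat \<Rightarrow>\<^sub>0 nat) \<Rightarrow>\<^sub>0 'k::field)) set)
       = Idl\<^bsub>principal_intersection_algebra n a b\<^esub>
           ((\<lambda>\<beta>. to_B n (monomial \<beta>)) ` canonical_generators n a b)"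
  (is "?M = Idl\<^bsub>?B\<^esub> ?G")
proof
  obtain i where i: "i \<in> {1..n}" "0 < a i" "0 < b i" using assms(2) by blast
  have "?G \<subseteq> ?M"
    using canonical_generators_interior[of n a b]
    by (auto simp: canonical_module_def monomial_def intro!: imageI single_in_canonical_ideal)
  moreover have "ideal ?M ?B"
    unfolding canonical_module_eq by (rule ideal_supported_on_interior)
  ultimately show "Idl\<^bsub>?B\<^esub> ?G \<subseteq> ?M" unfolding genideal_def by blast
  show "?M \<subseteq> Idl\<^bsub>?B\<^esub> ?G"
    unfolding genideal_def
  proof (intro Inter_greatest subsetI)
    fix I f assume "I \<in> {I. ideal I ?B \<and> ?G \<subseteq> I}" and "f \<in> ?M"
    then have I: "ideal I ?B" and G: "?G \<subseteq> I" by blast+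
    interpret ideal I ?B by (rule I)
    obtain p where p: "p \<in> canonical_ideal n a b" and f: "f = to_B n p"
      using \<open>f \<in> ?M\<close> unfolding canonical_module_def by blast
    have ops: "x \<otimes>\<^bsub>?B\<^esub> y = x * y" "x \<oplus>\<^bsub>?B\<^esub> y = x + y" "\<zero>\<^bsub>?B\<^esub> = 0" for x y
      by (simp_all add: principal_intersection_algebra_eq sub_ring_def)
    from p have "to_B n p \<in> I"
    proof (induction rule: canonical_ideal_induct)
      case zero
      show ?case using additive_subgroup.zero_closed[OF ideal.axioms(1)[OF I]] unfolding to_B_0 ops .
    next
      case (add \<beta> c p)
      obtain g \<delta> where g: "g \<in> canonical_generators n a b" and \<delta>: "\<delta> \<in> E_Phi n a b" and \<beta>: "\<beta> = \<delta> + g"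
        using E_Phi_interior_factor[OF i add(1)] by (metis add.commute)
      have "to_B n (Poly_Mapping.single \<delta> c) \<in> carrier ?B"
        using in_cone_of_E_Phi[OF \<delta>]
        by (simp add: to_B_single principal_intersection_algebra_eq sub_ring_def supported_on_uv_term)
      moreover have "to_B n (monomial g) \<in> I" using G g by blast
      ultimately have "to_B n (Poly_Mapping.single \<delta> c) * to_B n (Poly_Mapping.single g 1) \<in> I"
        using I_l_closed unfolding ops monomial_def by blast
      then have "to_B n (Poly_Mapping.single \<beta> c) \<in> I"
        unfolding \<beta> by (simp flip: to_B_single_add)
      then show ?case
        using add(2) additive_subgroup.a_closed[OF ideal.axioms(1)[OF I]] unfolding ops to_B_add by blast
    qed
    then show "f \<in> I" unfolding f .
  qed
qed

end
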